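(* Let $n\ge 1$. Suppose $\boldsymbol{p}\in\mathbb{R}^n$ with $\boldsymbol{p}>\boldsymbol{0}$ and $\boldsymbol{S}=[S_1,\ldots,S_n]^\top:[0,1]\to\mathbb{R}^n$ satisfy (i) $\boldsymbol{p}\ge\boldsymbol{0}$; (ii) $\boldsymbol{p}^\top\boldsymbol{1}=1$; (iii) $\boldsymbol{S}(0)=\boldsymbol{0}$; (iv) $\boldsymbol{S}(1)=\boldsymbol{1}$; (v) $\boldsymbol{S}(z)\le\boldsymbol{S}(\hat z)$ for all $z,\hat z\in[0,1]$ with $z\le\hat z$; (vi) $\boldsymbol{p}^\top\boldsymbol{S}(z)=z$ for all $z\in[0,1]$. Let $\boldsymbol{q}\in\mathbb{R}^n$ with $\boldsymbol{q}>\boldsymbol{0}$ be a given vector satisfying $\boldsymbol{q}\ge\boldsymbol{0}$ and $\boldsymbol{q}^\top\boldsymbol{1}=1$. Then for any $U\in\mathcal{U}$, the vector $\boldsymbol{q}$ and the function $\boldsymbol{T}(z)=U\boldsymbol{S}(z)$, $z\in[0,1]$, satisfy $\boldsymbol{T}(0)=\boldsymbol{0}$; $\boldsymbol{T}(1)=\boldsymbol{1}$; $\boldsymbol{T}(z)\le\boldsymbol{T}(\hat z)$ for all $z,\hat z\in[0,1]$ with $z\le\hat z$; and $\boldsymbol{q}^\top\boldsymbol{T}(z)=z$ for all $z\in[0,1]$.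
   Context: Vectors are column vectors; inequalities between vectors or matrices are entrywise; $\boldsymbol{1}$ is the all-ones vector and $\boldsymbol{0}$ the zero vector. For $\boldsymbol{p},\boldsymbol{q}\in\mathbb{R}^n$, $$\mathcal{U}=\{U\in\mathbb{R}^{n\times n}: U^\top\boldsymbol{q}=\boldsymbol{p},\ U\boldsymbol{1}=\boldsymbol{1},\ U\ge 0\}.$$ *)

theory Defs
  imports "HOL-Analysis.Analysis"
begin

text \<open>
  On \<open>real ^ 'n\<close> and \<open>real ^ 'n ^ 'n\<close> the library order \<open>\<le>\<close> is entrywise and
  \<open>1 :: real ^ 'n\<close> is the all-ones vector (whereas \<open>1\<close> on matrices is the all-ones matrix).
  The library's \<open><\<close> on vectors is not the entrywise strict order (it only means \<open>\<le>\<close> and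
  \<open>\<noteq>\<close>), hence the separate definition below.
\<close>

definition vec_pos :: "real ^ 'n \<Rightarrow> bool" where
  "vec_pos x \<longleftrightarrow> (\<forall>i. 0 < x $ i)"

definition U_set :: "real ^ 'n \<Rightarrow> real ^ 'n \<Rightarrow> (real ^ 'n ^ 'n) set" where
  "U_set p q = {U. transpose U *v q = p \<and> U *v 1 = 1 \<and> 0 \<le> U}"

end

theory Submission
  imports Defs
begin

text \<open>
  A matrix \<open>U\<close> with nonnegative entries acts monotonically on vectors, so \<open>U\<close> carries the
  monotone curve \<open>S\<close> to a monotone curve. Linearity together with \<open>U *v 1 = 1\<close> preserves
  the endpoints \<open>0\<close> and \<open>1\<close>. The weighted average is preserved because \<open>U\<close> can be moved
  to the other side of the inner product as its transpose, which sends the weights \<open>q\<close> to \<open>p\<close>: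
  \<open>q \<bullet> (U *v S z) = (transpose U *v q) \<bullet> S z = p \<bullet> S z = z\<close>.
\<close>

lemma matrix_vector_mult_mono:
  fixes A :: "real ^ 'n ^ 'm"
  assumes "0 \<le> A" and "x \<le> y"
  shows "A *v x \<le> A *v y"
  using assms
  by (auto simp: less_eq_vec_def matrix_vector_mult_def intro!: sum_mono mult_left_mono)

theorem theorem15:
  fixes p q :: "real ^ 'n"
    and S T :: "real \<Rightarrow> real ^ 'n"
    and U :: "real ^ 'n ^ 'n"
  assumes p_pos: "vec_pos p"
    and p_nonneg: "0 \<le> p"
    and p_sum: "p \<bullet> 1 = 1"
    and S_0: "S 0 = 0"
    and S_1: "S 1 = 1"
    and S_mono: "\<forall>z\<in>{0..1}. \<forall>z'\<in>{0..1}. z \<le> z' \<longrightarrow> S z \<le> S z'"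
    and S_avg: "\<forall>z\<in>{0..1}. p \<bullet> S z = z"
    and q_pos: "vec_pos q"
    and q_nonneg: "0 \<le> q"
    and q_sum: "q \<bullet> 1 = 1"
    and U: "U \<in> U_set p q"
    and T: "\<forall>z\<in>{0..1}. T z = U *v S z"
  shows "T 0 = 0 \<and> T 1 = 1 \<and>
    (\<forall>z\<in>{0..1}. \<forall>z'\<in>{0..1}. z \<le> z' \<longrightarrow> T z \<le> T z') \<and>
    (\<forall>z\<in>{0..1}. q \<bullet> T z = z)"
proof (intro conjI ballI impI)
  have adj: "transpose U *v q = p" and row_sums: "U *v 1 = 1" and nonneg: "0 \<le> U"
    using U by (auto simp: U_set_def)
  show "T 0 = 0"
    using T S_0 by simp
  show "T 1 = 1"
    using T S_1 row_sums by simp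
  show "T z \<le> T z'" if "z \<in> {0..1}" "z' \<in> {0..1}" "z \<le> z'" for z z'
    using that T S_mono matrix_vector_mult_mono[OF nonneg] by simp
  show "q \<bullet> T z = z" if z: "z \<in> {0..1}" for z
  proof -
    have "q \<bullet> T z = (transpose U *v q) \<bullet> S z"
      using T z by (simp add: dot_lmul_matrix)
    also have "\<dots> = z"
      using adj S_avg z by simp
    finally show ?thesis .
  qed
qed

end
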